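(* Let $X$ be a separable complex Banach space, let $k\ge 1$, let $T_1,\ldots,T_k$ be bounded linear operators on $X$, and let $T=T_1\oplus\cdots\oplus T_k$. If every $T_i$ $(1\le i\le k)$ is disk transitive and at least $k-1$ of the operators $T_1,\ldots,T_k$ are compound, then $T$ is $k$-bitransitive.
   Context: $\mathbb{D}=\{z\in\mathbb{C}:|z|\le 1\}$ is the closed unit disk; $\mathbb{N}$ is the set of positive integers. $\bigoplus_{i=1}^k X$ is the $k$-fold direct sum of $X$ (with any of the usual equivalent norms), and $T_1\oplus\cdots\oplus T_k$ acts on it by $(x_1,\ldots,x_k)\mapsto(T_1x_1,\ldots,T_kx_k)$. For sets $A_i\subset X$, $A_1\oplus\cdots\oplus A_k=\{(a_1,\ldots,a_k):a_i\in A_i\}$. Disk transitive: a bounded linear operator $S$ on $X$ is disk transitive if for all nonempty open $U,V\subset X$ there exist $n\in\mathbb{N}$ and $\alpha\in\mathbb{D}\setminus\{0\}$ with $S^n(\alpha U)\cap V\neq\emptyset$ (equivalently, $S$ is $1$-bitransitive). Compound: a bounded linear operator $S$ on $X$ is compound if for all nonempty open $U,V\subset X$ there exist $N\in\mathbb{N}$ and a sequence $(\alpha_n)\subset\mathbb{D}\setminus\{0\}$ such that $S^n(\alpha_nU)\cap V\neq\emptyset$ for all $n\ge N$. $k$-bitransitive: an operator $T$ on $\bigoplus_{i=1}^k X$ is $k$-bitransitive if there exist bounded linear operators $T_1,\ldots,T_k$ on $X$ with $T=T_1\oplus\cdots\oplus T_k$ such that for all nonempty open sets $U_1,\ldots,U_k,V_1,\ldots,V_k\subset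 X$ there exist $n\in\mathbb{N}$ and $\alpha_1,\ldots,\alpha_k\in\mathbb{D}\setminus\{0\}$ with $(T_1\oplus\cdots\oplus T_k)^n(\alpha_1U_1\oplus\cdots\oplus\alpha_kU_k)\cap(V_1\oplus\cdots\oplus V_k)\neq\emptyset$. *)

theory Defs
  imports "HOL-Analysis.Analysis"
begin

text \<open>
  The libraries have only real normed vector spaces as a type class. A complex one is a real one with
  a complex scalar multiplication that extends the real one and is compatible with the norm.
\<close>

class complex_normed_vector = real_normed_vector +
  fixes scaleC :: "complex \<Rightarrow> 'a \<Rightarrow> 'a"  (infixr "*\<^sub>C" 75)
  assumes scaleC_add_right: "a *\<^sub>C (x + y) = a *\<^sub>C x + a *\<^sub>C y"
    and scaleC_add_left: "(a + b) *\<^sub>C x = a *\<^sub>C x + b *\<^sub>C x"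
    and scaleC_scaleC: "a *\<^sub>C b *\<^sub>C x = (a * b) *\<^sub>C x"
    and scaleC_one: "1 *\<^sub>C x = x"
    and scaleR_scaleC: "r *\<^sub>R x = complex_of_real r *\<^sub>C x"
    and norm_scaleC: "norm (a *\<^sub>C x) = cmod a * norm x"

class complex_banach = complex_normed_vector + banach

instantiation complex :: complex_banach
begin

definition scaleC_complex :: "complex \<Rightarrow> complex \<Rightarrow> complex"
  where "scaleC_complex a x = a * x"

instance
  by standard (simp_all add: scaleC_complex_def algebra_simps norm_mult scaleR_conv_of_real)

end

text \<open>
  For finite index types \<open>'k\<close>, the type \<open>'a ^ 'k\<close> carries the \<open>\<ell>\<^sup>2\<close> norm and the product topology. It
  renders the \<open>k\<close>-fold direct sum of \<open>'a\<close> with \<open>k = CARD('k)\<close>; \<open>k \<ge> 1\<close> as types are nonempty.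
\<close>

instantiation vec :: (complex_normed_vector, finite) complex_normed_vector
begin

definition scaleC_vec :: "complex \<Rightarrow> 'a ^ 'b \<Rightarrow> 'a ^ 'b"
  where "scaleC_vec a x = (\<chi> i. a *\<^sub>C (x $ i))"

instance
proof
  fix a b :: complex and r :: real and x y :: "'a ^ 'b"
  show "a *\<^sub>C (x + y) = a *\<^sub>C x + a *\<^sub>C y"
    by (simp add: scaleC_vec_def vec_eq_iff scaleC_add_right)
  show "(a + b) *\<^sub>C x = a *\<^sub>C x + b *\<^sub>C x"
    by (simp add: scaleC_vec_def vec_eq_iff scaleC_add_left)
  show "a *\<^sub>C b *\<^sub>C x = (a * b) *\<^sub>C x"
    by (simp add: scaleC_vec_def vec_eq_iff scaleC_scaleC)
  show "1 *\<^sub>C x = x"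
    by (simp add: scaleC_vec_def vec_eq_iff scaleC_one)
  show "r *\<^sub>R x = complex_of_real r *\<^sub>C x"
    by (simp add: scaleC_vec_def vec_eq_iff scaleR_scaleC)
  show "norm (a *\<^sub>C x) = cmod a * norm x"
    by (simp add: scaleC_vec_def norm_vec_def norm_scaleC L2_set_right_distrib)
qed

end

instance vec :: (complex_banach, finite) complex_banach ..

definition bounded_clinear ::
    "('a::complex_normed_vector \<Rightarrow> 'b::complex_normed_vector) \<Rightarrow> bool"
  where "bounded_clinear f \<longleftrightarrow> bounded_linear f \<and> (\<forall>c x. f (c *\<^sub>C x) = c *\<^sub>C f x)"

definition disk_transitive :: "('a::complex_banach \<Rightarrow> 'a) \<Rightarrow> bool"
  where "disk_transitive S \<longleftrightarrow>
    bounded_clinear S \<and>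
    (\<forall>U V. open U \<and> U \<noteq> {} \<and> open V \<and> V \<noteq> {} \<longrightarrow>
      (\<exists>n\<ge>1. \<exists>\<alpha>\<in>cball 0 1 - {0}. (S ^^ n) ` (scaleC \<alpha> ` U) \<inter> V \<noteq> {}))"

definition compound :: "('a::complex_banach \<Rightarrow> 'a) \<Rightarrow> bool"
  where "compound S \<longleftrightarrow>
    bounded_clinear S \<and>
    (\<forall>U V. open U \<and> U \<noteq> {} \<and> open V \<and> V \<noteq> {} \<longrightarrow>
      (\<exists>N\<ge>1. \<exists>\<alpha>::nat \<Rightarrow> complex. (\<forall>n. \<alpha> n \<in> cball 0 1 - {0}) \<and>
        (\<forall>n\<ge>N. (S ^^ n) ` (scaleC (\<alpha> n) ` U) \<inter> V \<noteq> {})))"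

definition direct_sum_op :: "('k::finite \<Rightarrow> 'a \<Rightarrow> 'a) \<Rightarrow> 'a ^ 'k \<Rightarrow> 'a ^ 'k"
  where "direct_sum_op T x = (\<chi> i. T i (x $ i))"

definition direct_sum_set :: "('k::finite \<Rightarrow> 'a set) \<Rightarrow> ('a ^ 'k) set"
  where "direct_sum_set A = {x. \<forall>i. x $ i \<in> A i}"

text \<open>The number \<open>k\<close> is determined by the type of the operator.\<close>

definition k_bitransitive :: "('a::complex_banach ^ 'k::finite \<Rightarrow> 'a ^ 'k) \<Rightarrow> bool"
  where "k_bitransitive T \<longleftrightarrow>
    (\<exists>S :: 'k \<Rightarrow> 'a \<Rightarrow> 'a. (\<forall>i. bounded_clinear (S i)) \<and> T = direct_sum_op S \<and>
      (\<forall>U V :: 'k \<Rightarrow> 'a set.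
        (\<forall>i. open (U i) \<and> U i \<noteq> {} \<and> open (V i) \<and> V i \<noteq> {}) \<longrightarrow>
        (\<exists>n\<ge>1. \<exists>\<alpha> :: 'k \<Rightarrow> complex. (\<forall>i. \<alpha> i \<in> cball 0 1 - {0}) \<and>
          (direct_sum_op S ^^ n) ` direct_sum_set (\<lambda>i. scaleC (\<alpha> i) ` U i)
            \<inter> direct_sum_set V \<noteq> {})))"

end

theory Submission
  imports Defs
begin

text \<open>
  A disk transitive operator has dense range, so in the definition the target \<open>V\<close> may be replaced by
  its preimage under a power of the operator; hence the exponents \<open>n\<close> can be taken arbitrarily large.
  Beyond some threshold every exponent works for the compound summands, and the only other summand
  picks one beyond that threshold.
\<close>

lemma direct_sum_op_funpow: "(direct_sum_op T ^^ n) x $ i = (T i ^^ n) (x $ i)"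
  by (induction n) (simp_all add: direct_sum_op_def)

lemma scaled_image_meets_iff:
  "f ` (scaleC \<alpha> ` U) \<inter> V \<noteq> {} \<longleftrightarrow> (\<exists>x\<in>U. f (\<alpha> *\<^sub>C x) \<in> V)"
  by auto

lemma disk_transitiveE:
  assumes "disk_transitive S" "open U" "U \<noteq> {}" "open V" "V \<noteq> {}"
  obtains n \<alpha> x where "n \<ge> 1" "\<alpha> \<in> cball 0 1 - {0}" "x \<in> U" "(S ^^ n) (\<alpha> *\<^sub>C x) \<in> V"
proof -
  have "\<exists>n\<ge>1. \<exists>\<alpha>\<in>cball 0 1 - {0}. \<exists>x\<in>U. (S ^^ n) (\<alpha> *\<^sub>C x) \<in> V"
    using assms unfolding disk_transitive_def scaled_image_meets_iff by simp
  with that show thesis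
    by blast
qed

text \<open>The sequence of scalars becomes a separate choice for each exponent, so that compound
  and disk transitive operators yield witnesses of the same pointwise form.\<close>

lemma compoundE:
  assumes "compound S" "open U" "U \<noteq> {}" "open V" "V \<noteq> {}"
  obtains N where "\<And>n. n \<ge> N \<Longrightarrow> \<exists>\<alpha>\<in>cball 0 1 - {0}. \<exists>x\<in>U. (S ^^ n) (\<alpha> *\<^sub>C x) \<in> V"
proof -
  have "\<exists>N\<ge>1. \<exists>\<alpha>. (\<forall>n. \<alpha> n \<in> cball 0 1 - {0}) \<and> (\<forall>n\<ge>N. \<exists>x\<in>U. (S ^^ n) (\<alpha> n *\<^sub>C x) \<in> V)"
    using assms unfolding compound_def scaled_image_meets_iff by simp
  with that show thesis
    by blast
qed

text \<open>Since \<open>n \<ge> 1\<close>, the point of \<open>V\<close> reached from the whole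
  space is the image under \<open>S\<close> of some point. With \<open>V\<close> arbitrary, this is
  the density of the range.\<close>

lemma disk_transitive_vimage_nonempty:
  assumes "disk_transitive S" "open V" "V \<noteq> {}"
  shows "S -` V \<noteq> {}"
proof -
  obtain n \<alpha> x where "n \<ge> 1" "(S ^^ n) (\<alpha> *\<^sub>C x) \<in> V"
    by (rule disk_transitiveE[OF assms(1) open_UNIV UNIV_not_empty assms(2,3)])
  then show ?thesis
    by (cases n) auto
qed

lemma disk_transitive_large_exponentE:
  assumes S: "disk_transitive S" and U: "open U" "U \<noteq> {}" and V: "open V" "V \<noteq> {}"
  obtains n \<alpha> x where "n \<ge> N" "n \<ge> 1" "\<alpha> \<in> cball 0 1 - {0}" "x \<in> U" "(S ^^ n) (\<alpha> *\<^sub>C x) \<in> V"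
  using V
proof (induction N arbitrary: V thesis)
  case 0
  show ?case
    by (rule disk_transitiveE[OF S U "0.prems"(2,3)]) (rule "0.prems"(1)[OF le0])
next
  case (Suc N)
  have "bounded_linear S"
    using S unfolding disk_transitive_def bounded_clinear_def by blast
  then have "open (S -` V)"
    using Suc.prems(2) by (intro open_vimage linear_continuous_on)
  moreover have "S -` V \<noteq> {}"
    using disk_transitive_vimage_nonempty[OF S Suc.prems(2,3)] .
  ultimately obtain n \<alpha> x where n: "n \<ge> N"
    and x: "\<alpha> \<in> cball 0 1 - {0}" "x \<in> U" "(S ^^ n) (\<alpha> *\<^sub>C x) \<in> S -` V"
    using Suc.IH[of "S -` V" thesis] by metis
  show ?case
    by (rule Suc.prems(1)[of "Suc n" \<alpha> x]) (use n x in auto)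
qed

theorem theorem2p15:
  fixes T :: "'k::finite \<Rightarrow> 'a::complex_banach \<Rightarrow> 'a"
  assumes "separable_space (euclidean :: 'a topology)"
    and "\<And>i. bounded_clinear (T i)"
    and "\<And>i. disk_transitive (T i)"
    and "card {i. compound (T i)} \<ge> CARD('k) - 1"
  shows "k_bitransitive (direct_sum_op T)"
proof -
  have "card (- {i. compound (T i)}) \<le> 1"
    using assms(4) by (simp add: Compl_eq_Diff_UNIV card_Diff_subset)
  then have "\<not> compound (T i) \<Longrightarrow> \<not> compound (T j) \<Longrightarrow> i = j" for i j
    by (auto simp: card_le_Suc0_iff_eq)
  \<comment> \<open>If some operator is not compound, \<open>j\<close> is its unique index;
    otherwise any index will do.\<close>
  then obtain j where compound: "\<And>i. i \<noteq> j \<Longrightarrow> compound (T i)"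
    by blast
  show ?thesis
    unfolding k_bitransitive_def
  proof (intro exI[of _ T] conjI allI impI refl assms(2))
    fix U V :: "'k \<Rightarrow> 'a set"
    assume "\<forall>i. open (U i) \<and> U i \<noteq> {} \<and> open (V i) \<and> V i \<noteq> {}"
    then have UV: "open (U i)" "U i \<noteq> {}" "open (V i)" "V i \<noteq> {}" for i
      by simp_all
    let ?hits = "\<lambda>n i. \<exists>\<alpha>\<in>cball 0 1 - {0}. \<exists>x\<in>U i. (T i ^^ n) (\<alpha> *\<^sub>C x) \<in> V i"
    have "\<exists>N. \<forall>n\<ge>N. ?hits n i" if "i \<noteq> j" for i
      by (rule compoundE[OF compound[OF that] UV]) blast
    then obtain N where N: "\<And>i n. i \<noteq> j \<Longrightarrow> n \<ge> N i \<Longrightarrow> ?hits n i"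
      by metis
    \<comment> \<open>The operator \<open>T j\<close> dictates the common exponent. The maximum
      exists because the index type is finite; the value \<open>N j\<close> is arbitrary and can
      only raise the bound.\<close>
    obtain n \<alpha>\<^sub>j x\<^sub>j where n: "n \<ge> Max (range N)" "n \<ge> 1"
      and j: "\<alpha>\<^sub>j \<in> cball 0 1 - {0}" "x\<^sub>j \<in> U j" "(T j ^^ n) (\<alpha>\<^sub>j *\<^sub>C x\<^sub>j) \<in> V j"
      by (rule disk_transitive_large_exponentE[OF assms(3) UV])
    have "?hits n i" for i
    proof (cases "i = j")
      case True
      with j show ?thesis
        by blast
    next
      case False
      have "N i \<le> n"
        using n(1) by simp
      with False show ?thesis
        by (rule N)
    qed
    \<comment> \<open>With \<open>n\<close> now the same for all indices, scalars and points can be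
      chosen independently in each coordinate and assembled into one vector.\<close>
    then obtain \<alpha> x where \<alpha>: "\<And>i. \<alpha> i \<in> cball 0 1 - {0}"
      and x: "\<And>i. x i \<in> U i" "\<And>i. (T i ^^ n) (\<alpha> i *\<^sub>C x i) \<in> V i"
      by metis
    let ?y = "\<chi> i. \<alpha> i *\<^sub>C x i"
    have "?y \<in> direct_sum_set (\<lambda>i. scaleC (\<alpha> i) ` U i)"
      and "(direct_sum_op T ^^ n) ?y \<in> direct_sum_set V"
      using x by (simp_all add: direct_sum_set_def direct_sum_op_funpow)
    then have "(direct_sum_op T ^^ n) ` direct_sum_set (\<lambda>i. scaleC (\<alpha> i) ` U i)
        \<inter> direct_sum_set V \<noteq> {}"
      by blast
    with n(2) \<alpha> show "\<exists>n\<ge>1. \<exists>\<alpha>. (\<forall>i. \<alpha> i \<in> cball 0 1 - {0}) \<and>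
        (direct_sum_op T ^^ n) ` direct_sum_set (\<lambda>i. scaleC (\<alpha> i) ` U i) \<inter> direct_sum_set V \<noteq> {}"
      by (intro exI[of _ n] exI[of _ \<alpha>] conjI allI)
  qed
qed

end
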